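(* (The Third H-isomorphism Theorem) Let $P$ be an H-group and let $N$ and $M$ be normal saturated sub-H-groups of $P$ with $N$ contained in $M$. Then there is an isomorphism of groups $$P/M\;\cong\;\frac{P/N}{M/N}.$$
   Context: An H-group $(P,\mu,\eta,c)$ is a pointed space $(P,p_0)$ with continuous pointed maps $\mu:P\times P\to P$, $\eta:P\to P$ and the constant map $c:P\to P$ at $p_0$ such that, via pointed homotopies, $\mu(1_P,c)\simeq\mu(c,1_P)\simeq 1_P$, $\mu(\eta,1_P)\simeq\mu(1_P,\eta)\simeq c$ and $\mu(\mu\times 1_P)\simeq\mu(1_P\times\mu)$. Write $g.h=\mu(g,h)$ and $g^{-1}=\eta(g)$. An H-homomorphism between H-groups $(P,\mu,\eta,c)$ and $(Q,\mu_2,\eta_2,c_2)$ is a continuous map $\varphi:P\to Q$ with $\varphi\mu\simeq\mu_2(\varphi\times\varphi)$ and $\varphi\eta\simeq\eta_2\varphi$. A sub-H-group of $P$ is a pointed subspace $P'\ni p_0$ which is itself an H-group (with base point $p_0$) such that the inclusion $P'\to P$ is an H-homomorphism. A subset $A\subseteq P$ is saturated if it contains the path component in $P$ of each of its points. For $A\subseteq P$ and $g\in P$, write $g\,\widetilde{\in}\,A$ if there is a path in $P$ from $g$ to a point of $A$. The left coset of a sub-H-group $P'$ is $gP'=\{g'\in P\mid g^{-1}.g'\,\widetilde{\in}\,P'\}$. A sub-H-group $P'$ is normal if $g.g'.g^{-1}\,\widetilde{\in}\,P'$ for all $g\in P$, $g'\in P'$; then $P/P'=\{gP'\mid g\in P\}$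 is a group under $(g_1P').(g_2P')=(g_1.g_2)P'$. In the claim, $M/N=\{mN\mid m\in M\}$, regarded as a (normal) subgroup of $P/N$. *)

theory Defs
  imports "HOL-Analysis.Homotopy" "HOL-Algebra.Coset"
begin

text \<open>
  The underlying set of an H-group is the \<open>topspace\<close> of its topology; the values of
  \<open>hmult\<close> and \<open>hinv\<close> outside of it are irrelevant.  The constant map \<open>c\<close> of an H-group
  is determined by the base point and is therefore not a separate component.
\<close>

record 'a H_struct =
  hspace :: "'a topology"
  hbase :: 'a
  hmult :: "'a \<times> 'a \<Rightarrow> 'a"
  hinv :: "'a \<Rightarrow> 'a"

definition hconst :: "('a, 'm) H_struct_scheme \<Rightarrow> 'a \<Rightarrow> 'a" where
  "hconst P = (\<lambda>_. hbase P)"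

definition pointed_homotopic ::
    "'a topology \<Rightarrow> 'a \<Rightarrow> 'b topology \<Rightarrow> 'b \<Rightarrow> ('a \<Rightarrow> 'b) \<Rightarrow> ('a \<Rightarrow> 'b) \<Rightarrow> bool" where
  "pointed_homotopic X x0 Y y0 f g \<longleftrightarrow> homotopic_with (\<lambda>h. h x0 = y0) X Y f g"

definition H_group :: "('a, 'm) H_struct_scheme \<Rightarrow> bool" where
  "H_group P \<longleftrightarrow>
     (let X = hspace P; p0 = hbase P; \<mu> = hmult P; \<eta> = hinv P; c = hconst P in
      p0 \<in> topspace X \<and>
      continuous_map (prod_topology X X) X \<mu> \<and> \<mu> (p0, p0) = p0 \<and>
      continuous_map X X \<eta> \<and> \<eta> p0 = p0 \<and>
      pointed_homotopic X p0 X p0 (\<lambda>x. \<mu> (x, c x)) (\<lambda>x. x) \<and>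
      pointed_homotopic X p0 X p0 (\<lambda>x. \<mu> (c x, x)) (\<lambda>x. x) \<and>
      pointed_homotopic X p0 X p0 (\<lambda>x. \<mu> (\<eta> x, x)) c \<and>
      pointed_homotopic X p0 X p0 (\<lambda>x. \<mu> (x, \<eta> x)) c \<and>
      pointed_homotopic (prod_topology X (prod_topology X X)) (p0, p0, p0) X p0
        (\<lambda>(x, y, z). \<mu> (\<mu> (x, y), z)) (\<lambda>(x, y, z). \<mu> (x, \<mu> (y, z))))"

text \<open>
  The homotopies in an H-homomorphism are free.  For the sub-H-groups below this is the
  most inclusive reading: asking for pointed homotopies would only leave fewer of them.
\<close>

definition H_hom ::
    "('a, 'm) H_struct_scheme \<Rightarrow> ('b, 'n) H_struct_scheme \<Rightarrow> ('a \<Rightarrow> 'b) \<Rightarrow> bool" where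
  "H_hom P Q \<phi> \<longleftrightarrow>
     continuous_map (hspace P) (hspace Q) \<phi> \<and>
     homotopic_with (\<lambda>_. True) (prod_topology (hspace P) (hspace P)) (hspace Q)
       (\<lambda>(x, y). \<phi> (hmult P (x, y))) (\<lambda>(x, y). hmult Q (\<phi> x, \<phi> y)) \<and>
     homotopic_with (\<lambda>_. True) (hspace P) (hspace Q)
       (\<lambda>x. \<phi> (hinv P x)) (\<lambda>x. hinv Q (\<phi> x))"

text \<open>
  A sub-H-group carries its own operations \<open>\<mu>'\<close>, \<open>\<eta>'\<close>, which need not be restrictions of those
  of \<open>P\<close>.  Cosets do not depend on them, so only their existence is recorded.
\<close>

definition sub_H_group :: "'a set \<Rightarrow> 'a H_struct \<Rightarrow> bool" where
  "sub_H_group S P \<longleftrightarrow>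
     S \<subseteq> topspace (hspace P) \<and> hbase P \<in> S \<and>
     (\<exists>\<mu>' \<eta>'. let S' = \<lparr>hspace = subtopology (hspace P) S, hbase = hbase P,
                          hmult = \<mu>', hinv = \<eta>'\<rparr>
              in H_group S' \<and> H_hom S' P (\<lambda>x. x))"

definition saturated :: "'a set \<Rightarrow> 'a H_struct \<Rightarrow> bool" where
  "saturated A P \<longleftrightarrow> (\<forall>x\<in>A. path_component_of_set (hspace P) x \<subseteq> A)"

definition tilde_mem :: "'a H_struct \<Rightarrow> 'a \<Rightarrow> 'a set \<Rightarrow> bool" where
  "tilde_mem P g A \<longleftrightarrow> (\<exists>a\<in>A. path_component_of (hspace P) g a)"

definition H_coset :: "'a H_struct \<Rightarrow> 'a \<Rightarrow> 'a set \<Rightarrow> 'a set" where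
  "H_coset P g S = {g' \<in> topspace (hspace P). tilde_mem P (hmult P (hinv P g, g')) S}"

definition normal_sub_H_group :: "'a set \<Rightarrow> 'a H_struct \<Rightarrow> bool" where
  "normal_sub_H_group S P \<longleftrightarrow>
     sub_H_group S P \<and>
     (\<forall>g\<in>topspace (hspace P). \<forall>g'\<in>S. tilde_mem P (hmult P (hmult P (g, g'), hinv P g)) S)"

text \<open>
  \<open>H_coset_space P A S\<close> is \<open>{g S | g \<in> A}\<close>: it is the carrier of \<open>P/S\<close> when \<open>A\<close> is all of \<open>P\<close>,
  and it is \<open>M/N\<close>, as a subset of \<open>P/N\<close>, when \<open>A = M\<close> and \<open>S = N\<close>.
\<close>

definition H_coset_space :: "'a H_struct \<Rightarrow> 'a set \<Rightarrow> 'a set \<Rightarrow> 'a set set" where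
  "H_coset_space P A S = (\<lambda>g. H_coset P g S) ` A"

text \<open>
  The description in the product is unique when \<open>S\<close> is normal, the product of cosets being
  independent of the representatives \<open>g1\<close>, \<open>g2\<close>.
\<close>

definition H_quotient :: "'a H_struct \<Rightarrow> 'a set \<Rightarrow> 'a set monoid" where
  "H_quotient P S =
     \<lparr>carrier = H_coset_space P (topspace (hspace P)) S,
      mult = (\<lambda>A B. THE C. \<exists>g1\<in>topspace (hspace P). \<exists>g2\<in>topspace (hspace P).
                A = H_coset P g1 S \<and> B = H_coset P g2 S \<and> C = H_coset P (hmult P (g1, g2)) S),
      one = H_coset P (hbase P) S\<rparr>"

end

theory Submission
  imports Defs
begin

text \<open>
  The path components of \<open>P\<close> form a group \<open>\<pi>\<^sub>0 P\<close>, in which the components meeting a normal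
  sub-H-group \<open>S\<close> form a normal subgroup.  The coset \<open>g S\<close> is the union of the corresponding
  coset in \<open>\<pi>\<^sub>0 P\<close>, so \<open>P/S\<close> is a group.  The map \<open>g N \<mapsto> g M\<close> is then a surjective
  homomorphism from \<open>P/N\<close> to \<open>P/M\<close> with kernel \<open>M/N\<close>.
\<close>

text \<open>The track of a fixed point under a homotopy is a path. Every homotopy below, pointed or
  free, is used only through this pointwise consequence.\<close>

lemma homotopic_with_imp_path_component_of:
  assumes "homotopic_with Q X Y f g" and x: "x \<in> topspace X"
  shows "path_component_of Y (f x) (g x)"
proof -
  obtain h where h: "continuous_map (prod_topology (top_of_set {0..1::real}) X) Y h"
    and h0: "h (0, x) = f x" and h1: "h (1, x) = g x"
    using assms(1) unfolding homotopic_with_def by blast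
  have "continuous_map (top_of_set {0..1}) (prod_topology (top_of_set {0..1::real}) X) (\<lambda>t. (t, x))"
    using x by (intro continuous_map_pairedI) auto
  then have "pathin Y (h \<circ> (\<lambda>t. (t, x)))"
    unfolding pathin_def using h by (rule continuous_map_compose)
  then show ?thesis
    unfolding path_component_of_def using h0 h1 by (intro exI[of _ "h \<circ> (\<lambda>t. (t, x))"]) simp
qed

section \<open>The group of path components\<close>

locale H_grp =
  fixes P :: "'a H_struct"
  assumes H_group: "H_group P"
begin

abbreviation T where "T \<equiv> topspace (hspace P)"
abbreviation mu (infixl "\<diamondop>" 70) where "x \<diamondop> y \<equiv> hmult P (x, y)"
abbreviation eta where "eta \<equiv> hinv P"
abbreviation path_rel (infix "\<frown>" 50) where "x \<frown> y \<equiv> path_component_of (hspace P) x y"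
abbreviation pcomp where "pcomp x \<equiv> path_component_of_set (hspace P) x"

lemma base_in: "hbase P \<in> T"
  and mu_continuous: "continuous_map (prod_topology (hspace P) (hspace P)) (hspace P) (hmult P)"
  and eta_continuous: "continuous_map (hspace P) (hspace P) eta"
  using H_group by (auto simp: H_group_def Let_def)

lemma mu_in: "x \<in> T \<Longrightarrow> y \<in> T \<Longrightarrow> x \<diamondop> y \<in> T"
  using continuous_map_image_subset_topspace[OF mu_continuous] by auto

lemma eta_in: "x \<in> T \<Longrightarrow> eta x \<in> T"
  using continuous_map_image_subset_topspace[OF eta_continuous] by auto

lemma mu_base_left: "x \<in> T \<Longrightarrow> hbase P \<diamondop> x \<frown> x"
  and mu_eta_left: "x \<in> T \<Longrightarrow> eta x \<diamondop> x \<frown> hbase P"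
  using H_group homotopic_with_imp_path_component_of
  unfolding H_group_def Let_def pointed_homotopic_def hconst_def by fastforce+

lemma mu_assoc:
  assumes "x \<in> T" "y \<in> T" "z \<in> T"
  shows "x \<diamondop> y \<diamondop> z \<frown> x \<diamondop> (y \<diamondop> z)"
proof -
  have "homotopic_with (\<lambda>h. h (hbase P, hbase P, hbase P) = hbase P)
      (prod_topology (hspace P) (prod_topology (hspace P) (hspace P))) (hspace P)
      (\<lambda>(x, y, z). x \<diamondop> y \<diamondop> z) (\<lambda>(x, y, z). x \<diamondop> (y \<diamondop> z))"
    using H_group unfolding H_group_def Let_def pointed_homotopic_def by blast
  from homotopic_with_imp_path_component_of[OF this, of "(x, y, z)"] assms show ?thesis
    by simp
qed

text \<open>The component of a pair is the product of the components, and a continuous map carries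
  components into components. This makes the product of components well defined.\<close>

lemma mu_cong:
  assumes "x \<frown> x'" "y \<frown> y'"
  shows "x \<diamondop> y \<frown> x' \<diamondop> y'"
proof -
  have "(x', y') \<in> path_component_of_set (prod_topology (hspace P) (hspace P)) (x, y)"
    unfolding path_component_of_pair using assms by simp
  then show ?thesis
    using path_component_of_continuous_image[OF mu_continuous] by blast
qed

text \<open>Points outside \<open>T\<close> all have the empty component, so equal components yield
  a path only for a point of \<open>T\<close>.\<close>

lemma pcomp_eq_iff: "x \<in> T \<Longrightarrow> pcomp x = pcomp y \<longleftrightarrow> x \<frown> y"
  by (metis Collect_inj path_component_of_equiv path_component_of_eq)

lemma pcomp_eqI: "x \<frown> y \<Longrightarrow> pcomp x = pcomp y"
  by (metis path_component_of_equiv)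

text \<open>Factors are multiplied through representatives picked by \<open>SOME\<close>;
  \<open>mult_pi0\<close> shows that the choice does not matter.\<close>

definition pi0 :: "'a set monoid" where
  "pi0 = \<lparr>carrier = pcomp ` T,
    mult = (\<lambda>A B. pcomp ((SOME x. x \<in> A) \<diamondop> (SOME y. y \<in> B))),
    one = pcomp (hbase P)\<rparr>"

lemma carrier_pi0: "carrier pi0 = pcomp ` T" and one_pi0: "\<one>\<^bsub>pi0\<^esub> = pcomp (hbase P)"
  by (simp_all add: pi0_def)

lemma pcomp_carrier: "x \<in> T \<Longrightarrow> pcomp x \<in> carrier pi0"
  by (simp add: carrier_pi0)

lemma mult_pi0:
  assumes "x \<in> T" "y \<in> T"
  shows "pcomp x \<otimes>\<^bsub>pi0\<^esub> pcomp y = pcomp (x \<diamondop> y)"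
proof -
  have some: "z \<frown> (SOME z'. z' \<in> pcomp z)" if "z \<in> T" for z
  proof -
    have "z \<in> pcomp z"
      using that by (simp add: path_component_of_refl)
    from someI[of "\<lambda>z'. z' \<in> pcomp z", OF this] show ?thesis
      by simp
  qed
  show ?thesis
    unfolding pi0_def monoid.simps using mu_cong[OF some[OF assms(1)] some[OF assms(2)]]
    by (rule pcomp_eqI[symmetric])
qed

text \<open>The unit, inverse and associativity laws of an H-group hold up to a path at each point,
  hence strictly on components.\<close>

sublocale pi0: group pi0
proof (rule groupI)
  fix A assume "A \<in> carrier pi0"
  then obtain x where x: "x \<in> T" "A = pcomp x"
    by (auto simp: carrier_pi0)
  show "\<one>\<^bsub>pi0\<^esub> \<otimes>\<^bsub>pi0\<^esub> A = A"
    using x by (simp add: one_pi0 mult_pi0 base_in mu_base_left pcomp_eqI del: Collect_inj)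
  have "pcomp (eta x) \<otimes>\<^bsub>pi0\<^esub> A = \<one>\<^bsub>pi0\<^esub>"
    unfolding one_pi0 x(2) mult_pi0[OF eta_in[OF x(1)] x(1)] by (intro pcomp_eqI mu_eta_left x(1))
  then show "\<exists>B\<in>carrier pi0. B \<otimes>\<^bsub>pi0\<^esub> A = \<one>\<^bsub>pi0\<^esub>"
    using pcomp_carrier eta_in x(1) by blast
next
  show "\<one>\<^bsub>pi0\<^esub> \<in> carrier pi0"
    unfolding one_pi0 by (rule pcomp_carrier[OF base_in])
next
  fix A B assume "A \<in> carrier pi0" "B \<in> carrier pi0"
  then obtain x y where xy: "x \<in> T" "y \<in> T" and AB: "A = pcomp x" "B = pcomp y"
    by (auto simp: carrier_pi0)
  show "A \<otimes>\<^bsub>pi0\<^esub> B \<in> carrier pi0"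
    unfolding AB mult_pi0[OF xy] by (intro pcomp_carrier mu_in xy)
  fix C assume "C \<in> carrier pi0"
  then obtain z where z: "z \<in> T" and C: "C = pcomp z"
    by (auto simp: carrier_pi0)
  show "A \<otimes>\<^bsub>pi0\<^esub> B \<otimes>\<^bsub>pi0\<^esub> C = A \<otimes>\<^bsub>pi0\<^esub> (B \<otimes>\<^bsub>pi0\<^esub> C)"
    unfolding AB C using xy z by (simp only: mult_pi0 mu_in) (intro pcomp_eqI mu_assoc)
qed

lemma inv_pi0:
  assumes "x \<in> T"
  shows "inv\<^bsub>pi0\<^esub> (pcomp x) = pcomp (eta x)"
proof (rule pi0.inv_equality)
  show "pcomp (eta x) \<otimes>\<^bsub>pi0\<^esub> pcomp x = \<one>\<^bsub>pi0\<^esub>"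
    unfolding one_pi0 mult_pi0[OF eta_in[OF assms] assms] by (intro pcomp_eqI mu_eta_left assms)
qed (intro pcomp_carrier eta_in assms)+

section \<open>Sub-H-groups as subgroups of the group of components\<close>

lemma tilde_mem_iff: "g \<in> T \<Longrightarrow> tilde_mem P g S \<longleftrightarrow> pcomp g \<in> pcomp ` S"
  by (auto simp: tilde_mem_def pcomp_eq_iff)

text \<open>The sub-H-group has its own operations, but the inclusion is an H-homomorphism, so they
  agree with those of \<open>P\<close> up to a path in \<open>P\<close>. Closure of \<open>S\<close>
  under its own operations thus becomes closure of its components in \<open>pi0\<close>.\<close>

lemma subgroup_comps:
  assumes "sub_H_group S P"
  shows "subgroup (pcomp ` S) pi0"
proof -
  have S: "S \<subseteq> T" "hbase P \<in> S"
    using assms by (auto simp: sub_H_group_def)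
  obtain m e where
    "H_group \<lparr>hspace = subtopology (hspace P) S, hbase = hbase P, hmult = m, hinv = e\<rparr>"
    and hom: "H_hom \<lparr>hspace = subtopology (hspace P) S, hbase = hbase P, hmult = m, hinv = e\<rparr> P (\<lambda>x. x)"
    using assms unfolding sub_H_group_def Let_def by blast
  \<comment> \<open>Interpreting the locale at the sub-H-group itself provides that \<open>m\<close>
    and \<open>e\<close> map \<open>S\<close> into \<open>S\<close>.\<close>
  then interpret S: H_grp "\<lparr>hspace = subtopology (hspace P) S, hbase = hbase P, hmult = m, hinv = e\<rparr>"
    by unfold_locales
  have m_in: "m (x, y) \<in> S" if "x \<in> S" "y \<in> S" for x y
    using S.mu_in[of x y] that S by auto
  have e_in: "e x \<in> S" if "x \<in> S" for x
    using S.eta_in[of x] that S by auto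
  have m: "m (x, y) \<frown> x \<diamondop> y" if "x \<in> S" "y \<in> S" for x y
  proof -
    have "homotopic_with (\<lambda>_. True)
        (prod_topology (subtopology (hspace P) S) (subtopology (hspace P) S)) (hspace P)
        (\<lambda>(x, y). m (x, y)) (\<lambda>(x, y). x \<diamondop> y)"
      using hom by (simp add: H_hom_def)
    from homotopic_with_imp_path_component_of[OF this, of "(x, y)"] that S show ?thesis
      by auto
  qed
  have e: "e x \<frown> eta x" if "x \<in> S" for x
  proof -
    have "homotopic_with (\<lambda>_. True) (subtopology (hspace P) S) (hspace P) e eta"
      using hom by (simp add: H_hom_def)
    from homotopic_with_imp_path_component_of[OF this, of x] that S show ?thesis
      by auto
  qed
  show ?thesis
  proof (rule pi0.subgroupI)
    show "pcomp ` S \<subseteq> carrier pi0" "pcomp ` S \<noteq> {}"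
      using S by (auto simp: carrier_pi0)
  next
    fix A assume "A \<in> pcomp ` S"
    then obtain x where x: "x \<in> S" "A = pcomp x" by blast
    then have "inv\<^bsub>pi0\<^esub> A = pcomp (e x)"
      using S pcomp_eqI[OF e[OF x(1)]] inv_pi0[of x] by auto
    then show "inv\<^bsub>pi0\<^esub> A \<in> pcomp ` S"
      using e_in[OF x(1)] by blast
    fix B assume "B \<in> pcomp ` S"
    then obtain y where y: "y \<in> S" "B = pcomp y" by blast
    then have "A \<otimes>\<^bsub>pi0\<^esub> B = pcomp (m (x, y))"
      using S x pcomp_eqI[OF m[OF x(1) y(1)]] mult_pi0[of x y] by auto
    then show "A \<otimes>\<^bsub>pi0\<^esub> B \<in> pcomp ` S"
      using m_in[OF x(1) y(1)] by blast
  qed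
qed

lemma normal_comps:
  assumes "normal_sub_H_group S P"
  shows "pcomp ` S \<lhd> pi0"
  unfolding pi0.normal_inv_iff
proof (intro conjI ballI)
  have sub: "sub_H_group S P"
    using assms by (simp add: normal_sub_H_group_def)
  then show "subgroup (pcomp ` S) pi0"
    by (rule subgroup_comps)
  fix A B assume "A \<in> carrier pi0" "B \<in> pcomp ` S"
  then obtain x y where x: "x \<in> T" "A = pcomp x" and y: "y \<in> S" "B = pcomp y"
    by (auto simp: carrier_pi0)
  have yT: "y \<in> T"
    using y(1) sub by (auto simp: sub_H_group_def)
  have "tilde_mem P (x \<diamondop> y \<diamondop> eta x) S"
    using assms x(1) y(1) by (auto simp: normal_sub_H_group_def)
  then have "pcomp (x \<diamondop> y \<diamondop> eta x) \<in> pcomp ` S"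
    unfolding tilde_mem_iff[OF mu_in[OF mu_in[OF x(1) yT] eta_in[OF x(1)]]] .
  then show "A \<otimes>\<^bsub>pi0\<^esub> B \<otimes>\<^bsub>pi0\<^esub> inv\<^bsub>pi0\<^esub> A \<in> pcomp ` S"
    unfolding x(2) y(2) using x(1) yT by (simp only: mult_pi0 inv_pi0 mu_in eta_in)
qed

end

section \<open>Cosets of a normal sub-H-group\<close>

locale normal_H_grp = H_grp +
  fixes S :: "'a set"
  assumes normal: "normal_sub_H_group S P"
begin

lemma sub_T: "S \<subseteq> T"
  using normal by (auto simp: normal_sub_H_group_def sub_H_group_def)

sublocale comps: normal "pcomp ` S" pi0
  using normal by (rule normal_comps)

text \<open>The dictionary between the two kinds of coset: \<open>H_coset P g S\<close> is the union
  of the components forming a coset in \<open>pi0\<close>. The definition yields a left coset; the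
  right coset is preferred because factor groups are built from right cosets.\<close>

lemma mem_H_coset_iff:
  assumes "g \<in> T"
  shows "x \<in> H_coset P g S \<longleftrightarrow> x \<in> T \<and> pcomp x \<in> pcomp ` S #>\<^bsub>pi0\<^esub> pcomp g"
proof -
  have "x \<in> H_coset P g S \<longleftrightarrow> pcomp x \<in> pcomp ` S #>\<^bsub>pi0\<^esub> pcomp g" if x: "x \<in> T"
  proof -
    have "x \<in> H_coset P g S \<longleftrightarrow> inv\<^bsub>pi0\<^esub> pcomp g \<otimes>\<^bsub>pi0\<^esub> pcomp x \<in> pcomp ` S"
      using assms x by (simp only: H_coset_def mem_Collect_eq tilde_mem_iff mu_in eta_in inv_pi0 mult_pi0 simp_thms)
    also have "\<dots> \<longleftrightarrow> pcomp x \<in> pcomp g <#\<^bsub>pi0\<^esub> pcomp ` S"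
    proof
      assume "pcomp x \<in> pcomp g <#\<^bsub>pi0\<^esub> pcomp ` S"
      then obtain A where A: "A \<in> pcomp ` S" and eq: "pcomp x = pcomp g \<otimes>\<^bsub>pi0\<^esub> A"
        unfolding l_coset_def by blast
      have "inv\<^bsub>pi0\<^esub> pcomp g \<otimes>\<^bsub>pi0\<^esub> pcomp x = A"
        using pi0.inv_solve_left'[OF comps.mem_carrier[OF A] pcomp_carrier[OF assms] pcomp_carrier[OF x]] eq
        by blast
      with A show "inv\<^bsub>pi0\<^esub> pcomp g \<otimes>\<^bsub>pi0\<^esub> pcomp x \<in> pcomp ` S"
        by argo
    qed (rule comps.lcos_module_rev[OF pi0.group_axioms pcomp_carrier[OF assms] pcomp_carrier[OF x]])
    \<comment> \<open>Normality enters here: left and right cosets coincide.\<close>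
    also have "\<dots> \<longleftrightarrow> pcomp x \<in> pcomp ` S #>\<^bsub>pi0\<^esub> pcomp g"
      using bspec[OF comps.coset_eq pcomp_carrier[OF assms]] by argo
    finally show ?thesis .
  qed
  moreover have "x \<in> T" if "x \<in> H_coset P g S"
    using that unfolding H_coset_def by blast
  ultimately show ?thesis
    by argo
qed

lemma H_coset_eqI:
  assumes "g \<in> T" "g' \<in> T" "pcomp ` S #>\<^bsub>pi0\<^esub> pcomp g = pcomp ` S #>\<^bsub>pi0\<^esub> pcomp g'"
  shows "H_coset P g S = H_coset P g' S"
  by (intro equalityI subsetI) (simp_all only: mem_H_coset_iff[OF assms(1)] mem_H_coset_iff[OF assms(2)] assms(3))

lemma H_coset_cong:
  assumes "g \<frown> g'"
  shows "H_coset P g S = H_coset P g' S"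
  using path_component_in_topspace[OF assms] by (intro H_coset_eqI) (simp_all only: pcomp_eqI[OF assms])

lemma mem_H_coset_self: "g \<in> T \<Longrightarrow> g \<in> H_coset P g S"
  by (simp only: mem_H_coset_iff pi0.rcos_self[OF pcomp_carrier comps.subgroup_axioms])

lemma rcos_eq:
  assumes "g \<in> T" "g' \<in> H_coset P g S"
  shows "pcomp ` S #>\<^bsub>pi0\<^esub> pcomp g = pcomp ` S #>\<^bsub>pi0\<^esub> pcomp g'"
proof (rule pi0.repr_independence[OF _ pcomp_carrier comps.subgroup_axioms])
  show "pcomp g' \<in> pcomp ` S #>\<^bsub>pi0\<^esub> pcomp g"
    using assms(2) unfolding mem_H_coset_iff[OF assms(1)] ..
qed (fact assms(1))

lemma H_coset_eq_iff:
  assumes "g \<in> T" "g' \<in> T"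
  shows "H_coset P g S = H_coset P g' S \<longleftrightarrow> g' \<in> H_coset P g S"
proof
  assume "H_coset P g S = H_coset P g' S"
  then show "g' \<in> H_coset P g S"
    using mem_H_coset_self[OF assms(2)] by blast
next
  assume "g' \<in> H_coset P g S"
  with assms show "H_coset P g S = H_coset P g' S"
    by (intro H_coset_eqI rcos_eq)
qed

text \<open>The unit coset is the set of points joined by a path to \<open>S\<close>; this
  identifies the kernel in the final theorem.\<close>

lemma H_coset_base: "g \<in> T \<Longrightarrow> g \<in> H_coset P (hbase P) S \<longleftrightarrow> pcomp g \<in> pcomp ` S"
  unfolding mem_H_coset_iff[OF base_in] one_pi0[symmetric] pi0.coset_mult_one[OF comps.subset]
  by blast

section \<open>The quotient group \<open>P/S\<close>\<close>

lemma H_coset_mu_cong: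
  assumes "g \<in> T" "g' \<in> T" "k \<in> T" "k' \<in> T"
    and eq: "H_coset P g S = H_coset P g' S" "H_coset P k S = H_coset P k' S"
  shows "H_coset P (g \<diamondop> k) S = H_coset P (g' \<diamondop> k') S"
proof -
  have "pcomp ` S #>\<^bsub>pi0\<^esub> pcomp g = pcomp ` S #>\<^bsub>pi0\<^esub> pcomp g'"
    "pcomp ` S #>\<^bsub>pi0\<^esub> pcomp k = pcomp ` S #>\<^bsub>pi0\<^esub> pcomp k'"
    using assms H_coset_eq_iff rcos_eq by blast+
  \<comment> \<open>For a normal subgroup, \<open>rcos_sum\<close> expresses the coset of a product
    as the product of the cosets, so it depends on the two cosets alone.\<close>
  then have "pcomp ` S #>\<^bsub>pi0\<^esub> (pcomp g \<otimes>\<^bsub>pi0\<^esub> pcomp k) = pcomp ` S #>\<^bsub>pi0\<^esub> (pcomp g' \<otimes>\<^bsub>pi0\<^esub> pcomp k')"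
    using assms(1-4) by (metis comps.rcos_sum pcomp_carrier)
  then show ?thesis
    using assms(1-4) by (intro H_coset_eqI mu_in) (simp_all only: mult_pi0)
qed

text \<open>Evaluates the \<open>THE\<close> in \<open>H_quotient\<close>: the given representatives
  show existence, and \<open>H_coset_mu_cong\<close> gives uniqueness.\<close>

lemma mult_H_quotient:
  assumes "g \<in> T" "k \<in> T"
  shows "H_coset P g S \<otimes>\<^bsub>H_quotient P S\<^esub> H_coset P k S = H_coset P (g \<diamondop> k) S"
  unfolding H_quotient_def monoid.simps
proof (rule the_equality)
  fix C
  assume "\<exists>g1\<in>T. \<exists>g2\<in>T. H_coset P g S = H_coset P g1 S \<and> H_coset P k S = H_coset P g2 S \<and>
    C = H_coset P (g1 \<diamondop> g2) S"
  then show "C = H_coset P (g \<diamondop> k) S"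
    using H_coset_mu_cong[OF assms(1) _ assms(2)] by metis
qed (use assms in blast)

lemma carrier_H_quotient: "carrier (H_quotient P S) = (\<lambda>g. H_coset P g S) ` T"
  and one_H_quotient: "\<one>\<^bsub>H_quotient P S\<^esub> = H_coset P (hbase P) S"
  by (simp_all add: H_quotient_def H_coset_space_def)

text \<open>Each law holds up to a path in \<open>P\<close>, and \<open>H_coset_cong\<close> turns
  such a path into an equality of cosets.\<close>

sublocale quotient: group "H_quotient P S"
proof (rule groupI)
  fix A assume "A \<in> carrier (H_quotient P S)"
  then obtain x where x: "x \<in> T" and A: "A = H_coset P x S"
    unfolding carrier_H_quotient by blast
  show "\<one>\<^bsub>H_quotient P S\<^esub> \<otimes>\<^bsub>H_quotient P S\<^esub> A = A"
    unfolding A one_H_quotient mult_H_quotient[OF base_in x] by (rule H_coset_cong[OF mu_base_left[OF x]])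
  have "H_coset P (eta x) S \<otimes>\<^bsub>H_quotient P S\<^esub> A = \<one>\<^bsub>H_quotient P S\<^esub>"
    unfolding A one_H_quotient mult_H_quotient[OF eta_in[OF x] x]
    by (rule H_coset_cong[OF mu_eta_left[OF x]])
  then show "\<exists>B\<in>carrier (H_quotient P S). B \<otimes>\<^bsub>H_quotient P S\<^esub> A = \<one>\<^bsub>H_quotient P S\<^esub>"
    using eta_in[OF x] unfolding carrier_H_quotient by blast
next
  show "\<one>\<^bsub>H_quotient P S\<^esub> \<in> carrier (H_quotient P S)"
    unfolding carrier_H_quotient one_H_quotient using base_in by blast
next
  fix A B assume "A \<in> carrier (H_quotient P S)" "B \<in> carrier (H_quotient P S)"
  then obtain x y where xy: "x \<in> T" "y \<in> T" and AB: "A = H_coset P x S" "B = H_coset P y S"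
    unfolding carrier_H_quotient by blast
  show "A \<otimes>\<^bsub>H_quotient P S\<^esub> B \<in> carrier (H_quotient P S)"
    unfolding AB mult_H_quotient[OF xy] carrier_H_quotient using mu_in[OF xy] by blast
  fix C assume "C \<in> carrier (H_quotient P S)"
  then obtain z where z: "z \<in> T" and C: "C = H_coset P z S"
    unfolding carrier_H_quotient by blast
  show "A \<otimes>\<^bsub>H_quotient P S\<^esub> B \<otimes>\<^bsub>H_quotient P S\<^esub> C = A \<otimes>\<^bsub>H_quotient P S\<^esub> (B \<otimes>\<^bsub>H_quotient P S\<^esub> C)"
    unfolding AB C using xy z by (simp only: mult_H_quotient mu_in) (intro H_coset_cong mu_assoc)
qed

end

section \<open>The projection from \<open>P/N\<close> to \<open>P/M\<close> and its kernel\<close>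

theorem theorem4p8:
  fixes P :: "'a H_struct" and M N :: "'a set"
  assumes "H_group P"
    and "normal_sub_H_group N P" and "saturated N P"
    and "normal_sub_H_group M P" and "saturated M P"
    and "N \<subseteq> M"
  shows "group (H_quotient P M) \<and>
         H_coset_space P M N \<lhd> H_quotient P N \<and>
         H_quotient P M \<cong> H_quotient P N Mod H_coset_space P M N"
proof -
  interpret H_grp P by unfold_locales (fact assms(1))
  interpret N: normal_H_grp P N by unfold_locales (fact assms(2))
  interpret M: normal_H_grp P M by unfold_locales (fact assms(4))
  \<comment> \<open>Taking a union avoids choosing a representative: on a coset of \<open>N\<close>
    all the united cosets of \<open>M\<close> coincide.\<close>
  define \<psi> where "\<psi> X = (\<Union>g\<in>X. H_coset P g M)" for X
  have coset_le: "H_coset P g N \<subseteq> H_coset P g M" for g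
    using \<open>N \<subseteq> M\<close> by (auto simp: H_coset_def tilde_mem_def)
  have \<psi>: "\<psi> (H_coset P g N) = H_coset P g M" if g: "g \<in> T" for g
  proof -
    have "H_coset P g' M = H_coset P g M" if "g' \<in> H_coset P g N" for g'
      using that coset_le g M.H_coset_eq_iff N.mem_H_coset_iff by blast
    then show ?thesis
      \<comment> \<open>The coset contains \<open>g\<close>, so the union of the equal sets is not
        over an empty index set.\<close>
      unfolding \<psi>_def using N.mem_H_coset_self[OF g] by blast
  qed
  have "\<psi> \<in> hom (H_quotient P N) (H_quotient P M)"
    by (rule homI)
      (auto simp: N.carrier_H_quotient M.carrier_H_quotient \<psi> mu_in
        N.mult_H_quotient M.mult_H_quotient)
  then interpret \<psi>: group_hom "H_quotient P N" "H_quotient P M" \<psi>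
    by unfold_locales
  have surj: "\<psi> ` carrier (H_quotient P N) = carrier (H_quotient P M)"
    by (simp add: N.carrier_H_quotient M.carrier_H_quotient image_image \<psi>)
  have ker: "kernel (H_quotient P N) (H_quotient P M) \<psi> = H_coset_space P M N"
  proof (intro equalityI subsetI)
    fix X assume "X \<in> kernel (H_quotient P N) (H_quotient P M) \<psi>"
    then obtain g where g: "g \<in> T" and X: "X = H_coset P g N"
      and "H_coset P (hbase P) M = H_coset P g M"
      by (auto simp: kernel_def N.carrier_H_quotient M.one_H_quotient \<psi>)
    then have "g \<in> H_coset P (hbase P) M"
      using M.mem_H_coset_self by blast
    \<comment> \<open>The representative \<open>g\<close> is exchanged for a point of
      \<open>M\<close> in its path component, which has the same coset of \<open>N\<close>.\<close>
    then obtain m where "m \<in> M" "g \<frown> m"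
      using g by (auto simp: M.H_coset_base pcomp_eq_iff)
    then show "X \<in> H_coset_space P M N"
      unfolding X H_coset_space_def using N.H_coset_cong by blast
  next
    fix X assume "X \<in> H_coset_space P M N"
    then obtain m where m: "m \<in> M" and X: "X = H_coset P m N"
      by (auto simp: H_coset_space_def)
    have "m \<in> T"
      using m M.sub_T by blast
    \<comment> \<open>The component of \<open>m\<close> meets \<open>M\<close> in \<open>m\<close>
      itself, so \<open>m\<close> lies in the unit coset of \<open>M\<close>.\<close>
    moreover have "H_coset P (hbase P) M = H_coset P m M"
      using m \<open>m \<in> T\<close> M.H_coset_eq_iff M.H_coset_base base_in by blast
    ultimately show "X \<in> kernel (H_quotient P N) (H_quotient P M) \<psi>"
      unfolding X kernel_def by (simp add: N.carrier_H_quotient M.one_H_quotient \<psi>)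
  qed
  have normal: "H_coset_space P M N \<lhd> H_quotient P N"
    using \<psi>.normal_kernel unfolding ker .
  \<comment> \<open>The first isomorphism theorem for groups, with the kernel replaced by
    \<open>M/N\<close>.\<close>
  have "H_quotient P N Mod H_coset_space P M N \<cong> H_quotient P M"
    using \<psi>.FactGroup_iso[OF surj] unfolding ker .
  with normal show ?thesis
    \<comment> \<open>The isomorphism starts at the factor group; reversing it with
      \<open>iso_sym\<close> requires that its source is a group.\<close>
    using M.quotient.group_axioms group.iso_sym[OF normal.factorgroup_is_group] by blast
qed

end
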